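(* The set $$\{f\in C[0,1]:\ \lambda(D(f))>0\}$$ is Haar-countable in $C[0,1]$.
   Context: $C[0,1]$ is the space of continuous real-valued functions on $[0,1]$ with the supremum norm, regarded as an abelian Polish group under addition. $\lambda$ is Lebesgue measure on $[0,1]$. For $f\in C[0,1]$, $D(f)$ denotes the set of all $x\in[0,1]$ at which $f$ is differentiable, i.e. has a finite derivative (one-sided at the endpoints $0$ and $1$); it is a Borel set. A subset $A$ of an abelian Polish group $X$ is called Haar-countable if there are a Borel set $B\subseteq X$ with $A\subseteq B$ and a set $C\subseteq X$ homeomorphic to the Cantor space $\{0,1\}^{\mathbb{N}}$ such that $(C+x)\cap B$ is countable (possibly finite or empty) for all $x\in X$. *)

theory Defs
  imports "HOL-Analysis.Analysis"
begin

section \<open>The unit interval as a compact metric space\<close>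

class compact_metric_space = metric_space +
  assumes compact_UNIV_class: "compact (UNIV :: 'a set)"

typedef unit_interval = "{0..1::real}"
  morphisms real_of_ui ui_of_real
  by (rule exI[of _ 0]) simp

instantiation unit_interval :: metric_space
begin

definition dist_unit_interval :: "unit_interval \<Rightarrow> unit_interval \<Rightarrow> real" where
  "dist_unit_interval x y = dist (real_of_ui x) (real_of_ui y)"

definition uniformity_unit_interval :: "(unit_interval \<times> unit_interval) filter" where
  "uniformity_unit_interval = (INF e\<in>{0<..}. principal {(x, y). dist x y < e})"

definition open_unit_interval :: "unit_interval set \<Rightarrow> bool" where
  "open_unit_interval U \<longleftrightarrow> (\<forall>x\<in>U. eventually (\<lambda>(x', y). x' = x \<longrightarrow> y \<in> U) uniformity)"

instance
  by standard
    (auto simp: dist_unit_interval_def uniformity_unit_interval_def open_unit_interval_def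
       real_of_ui_inject dist_triangle2)

end

lemma range_ui_of_real: "ui_of_real ` {0..1} = UNIV"
  by (metis type_definition.Abs_image type_definition_unit_interval)

lemma continuous_on_ui_of_real: "continuous_on {0..1} ui_of_real"
  by (auto simp: continuous_on_iff dist_unit_interval_def ui_of_real_inverse)

instance unit_interval :: compact_metric_space
proof
  show "compact (UNIV :: unit_interval set)"
    using compact_continuous_image[OF continuous_on_ui_of_real] range_ui_of_real by auto
qed


section \<open>Spaces of continuous functions on a compact metric space are Polish\<close>

lemma countable_bcontfun_net:
  fixes e :: real
  assumes "e > 0"
  shows "\<exists>D :: ('a::compact_metric_space \<Rightarrow>\<^sub>C 'b::{metric_space, second_countable_topology}) set.
           countable D \<and> (\<forall>f. \<exists>h\<in>D. dist f h < e)"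
proof -
  define d where "d = e / 5"
  have d: "d > 0" using assms by (simp add: d_def)
  obtain E :: "'b set" where E: "countable E"
    "\<And>X. open X \<Longrightarrow> X \<noteq> {} \<Longrightarrow> \<exists>y\<in>E. y \<in> X"
    by (rule countable_dense_setE) blast
  have "\<exists>F :: 'a set. finite F \<and> UNIV \<subseteq> (\<Union>p\<in>F. ball p (inverse (real (Suc n))))" for n
    using compact_UNIV_class unfolding compact_eq_totally_bounded
    by (metis inverse_positive_iff_positive of_nat_0_less_iff zero_less_Suc)
  then obtain F :: "nat \<Rightarrow> 'a set"
    where F: "\<And>n. finite (F n)"
      "\<And>n. UNIV \<subseteq> (\<Union>p\<in>F n. ball p (inverse (real (Suc n))))"
    by metis
  define P where "P n g f \<longleftrightarrow>
      (\<forall>x y. dist x y < inverse (real (Suc n)) \<longrightarrow> dist (apply_bcontfun f x) (apply_bcontfun f y) < d) \<and>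
      (\<forall>p\<in>F n. dist (apply_bcontfun f p) (g p) < d)"
    for n :: nat and g :: "'a \<Rightarrow> 'b" and f :: "'a \<Rightarrow>\<^sub>C 'b"
  define I where "I = (SIGMA n:(UNIV :: nat set). Pi\<^sub>E (F n) (\<lambda>_. E))"
  define D where "D = (\<lambda>(n, g). SOME f. P n g f) ` I"
  have "countable I"
    unfolding I_def using F(1) E(1) by (intro countable_SIGMA countable_PiE) auto
  hence "countable D" by (simp add: D_def)
  moreover have "\<exists>h\<in>D. dist f h < e" for f
  proof -
    have "uniformly_continuous_on UNIV (apply_bcontfun f)"
      by (intro compact_uniformly_continuous compact_UNIV_class) simp
    then obtain r where r: "r > 0" "\<And>x y. dist x y < r \<Longrightarrow> dist (f x) (f y) < d"
      using d unfolding uniformly_continuous_on_def by (metis UNIV_I)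
    obtain n where n: "inverse (real (Suc n)) < r" using reals_Archimedean[OF r(1)] by blast
    have "\<exists>y\<in>E. dist (f p) y < d" for p
      using E(2)[of "ball (f p) d"] d by auto
    then obtain g0 where g0: "\<And>p. g0 p \<in> E" "\<And>p. dist (f p) (g0 p) < d" by metis
    define g where "g = restrict g0 (F n)"
    have "P n g f" unfolding P_def g_def using n r(2) g0(2) by (auto intro: order.strict_trans)
    define h where "h = (SOME f. P n g f)"
    have h: "P n g h" unfolding h_def by (rule someI) fact
    have "(n, g) \<in> I" using g0(1) by (auto simp: I_def g_def)
    hence "h \<in> D" unfolding D_def h_def by force
    moreover have "dist f h \<le> 4 * d"
    proof (rule dist_bound)
      fix x
      obtain p where p: "p \<in> F n" "dist p x < inverse (real (Suc n))" using subsetD[OF F(2)[of n], of x] by auto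
      have "dist (f p) (f x) < d" "dist (f p) (g p) < d" "dist (h p) (g p) < d" "dist (h p) (h x) < d"
        using p \<open>P n g f\<close> h unfolding P_def by auto
      thus "dist (f x) (h x) \<le> 4 * d"
        by metric
    qed
    ultimately show ?thesis using d unfolding d_def by (intro bexI[of _ h]) auto
  qed
  ultimately show ?thesis by blast
qed

instance bcontfun ::
  (compact_metric_space, "{metric_space, second_countable_topology}") second_countable_topology
proof
  have "\<exists>D :: ('a \<Rightarrow>\<^sub>C 'b) set. countable D \<and> (\<forall>f. \<exists>h\<in>D. dist f h < inverse (real (Suc n)))" for n
    by (rule countable_bcontfun_net) simp
  then obtain D :: "nat \<Rightarrow> ('a \<Rightarrow>\<^sub>C 'b) set"
    where D: "\<And>n. countable (D n)" "\<And>n f. \<exists>h\<in>D n. dist f h < inverse (real (Suc n))"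
    by metis
  define B where "B = (\<lambda>(n, h). ball h (inverse (real (Suc n)))) ` (SIGMA n:UNIV. D n)"
  have "countable B" unfolding B_def using D(1) by (intro countable_image countable_SIGMA) auto
  moreover have "topological_basis B"
  proof (rule topological_basisI)
    fix U and f :: "'a \<Rightarrow>\<^sub>C 'b"
    assume "open U" "f \<in> U"
    then obtain e where e: "e > 0" "ball f e \<subseteq> U" by (meson open_contains_ball)
    obtain n where n: "inverse (real (Suc n)) < e / 2" using reals_Archimedean[of "e / 2"] e by auto
    obtain h where h: "h \<in> D n" "dist f h < inverse (real (Suc n))" using D(2) by blast
    have "ball h (inverse (real (Suc n))) \<subseteq> ball f e"
    proof
      fix k assume "k \<in> ball h (inverse (real (Suc n)))"
      hence "dist h k < inverse (real (Suc n))" by simp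
      thus "k \<in> ball f e" using n h(2) dist_triangle[of f k h] by simp
    qed
    moreover have "ball h (inverse (real (Suc n))) \<in> B" using h(1) unfolding B_def by force
    ultimately show "\<exists>V\<in>B. f \<in> V \<and> V \<subseteq> U"
      using h(2) e(2) by (intro bexI[of _ "ball h (inverse (real (Suc n)))"]) (auto simp: dist_commute)
  qed (auto simp: B_def)
  ultimately show "\<exists>B :: ('a \<Rightarrow>\<^sub>C 'b) set set. countable B \<and> open = generate_topology B"
    using topological_basis_imp_subbasis by blast
qed

instance bcontfun :: (compact_metric_space, polish_space) polish_space ..


section \<open>Haar-countable sets\<close>

text \<open>The type \<open>nat \<Rightarrow> bool\<close> carries the product of the discrete topologies, so it is the Cantor space.\<close>

definition haar_countable :: "'a::{polish_space, topological_ab_group_add} set \<Rightarrow> bool" where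
  "haar_countable A \<longleftrightarrow>
     (\<exists>B C. B \<in> sets borel \<and> A \<subseteq> B \<and>
        C homeomorphic (UNIV :: (nat \<Rightarrow> bool) set) \<and>
        (\<forall>x. countable ((\<lambda>c. c + x) ` C \<inter> B)))"


section \<open>Points of differentiability\<close>

type_synonym C01 = "unit_interval \<Rightarrow>\<^sub>C real"

text \<open>
  \<open>f\<close> is transported to a function on the reals; its values outside \<open>{0..1}\<close> are arbitrary,
  but differentiability within \<open>{0..1}\<close> does not depend on them, and it is one-sided
  at the endpoints.
\<close>

definition diff_points :: "C01 \<Rightarrow> real set" where
  "diff_points f =
     {t \<in> {0..1}. (\<lambda>s. apply_bcontfun f (ui_of_real s)) differentiable (at t within {0..1})}"

end

theory Submission
  imports Defs
begin

text \<open>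
  The idea is to translate along a single line. Let \<open>w\<close> be Weierstrass's function, for which the
  difference quotients are unbounded at every point of \<open>{0..1}\<close> (\<open>weierstrass_steep\<close>). Let \<open>E f\<close>
  be the set of the points at which the difference quotients of \<open>f\<close> are bounded. If some \<open>x\<close>
  belonged to both \<open>E (s w + f)\<close> and \<open>E (t w + f)\<close> with \<open>s \<noteq> t\<close>, then it would belong to
  \<open>E ((s - t) w)\<close>, which is empty. So for fixed \<open>f\<close> the sets \<open>E (t w + f)\<close>, for real \<open>t\<close>, are
  pairwise disjoint subsets of \<open>{0..1}\<close>, and only countably many of them have positive measure
  (\<open>countable_positive_translates\<close>). Hence the image of the Cantor set under \<open>t \<mapsto> t w\<close> witnesses
  that \<open>{f. \<lambda> (E f) > 0}\<close> is Haar-countable.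

  A continuous function has bounded difference quotients wherever it is differentiable, so this
  set contains the one of the theorem. Passing from \<open>D f\<close> to the larger \<open>E f\<close> makes
  the Borel part easy: \<open>E f\<close> is the increasing union over \<open>n\<close> of the closed sets of points at which
  the quotients are bounded by \<open>n\<close>, so it has positive measure exactly if one of these sets has,
  and the measure of each of them is upper semicontinuous in \<open>f\<close>
  (\<open>closed_lipschitz_measure_ge\<close>). Therefore \<open>{f. \<lambda> (E f) > 0}\<close> is an \<open>F\<^sub>\<sigma>\<close> set.
\<close>


section \<open>A continuous function that is nowhere pointwise Lipschitz\<close>

text \<open>
  The ratios \<open>1/5\<close> and \<open>100\<close> only have to make the amplitudes decay fast and the slopes grow fast
  enough for each term to dominate all others at its own scale.
\<close>

definition weierstrass :: "real \<Rightarrow> real" where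
  "weierstrass x = (\<Sum>n. (1/5)^n * cos (100^n * x * pi))"

lemma norm_weierstrass_term_le: "norm ((1/5)^n * cos (100^n * x * pi)) \<le> (1/5::real)^n"
  by (simp add: abs_mult power_abs mult_left_le)

lemma summable_weierstrass: "summable (\<lambda>n. (1/5)^n * cos (100^n * x * pi) :: real)"
  by (rule summable_comparison_test'[where g = "\<lambda>n. (1/5)^n" and N = 0])
     (use norm_weierstrass_term_le in \<open>auto intro: summable_geometric\<close>)

lemma continuous_on_weierstrass: "continuous_on S weierstrass"
proof -
  have "uniform_limit S (\<lambda>n x. \<Sum>i<n. (1/5)^i * cos (100^i * x * pi))
          (\<lambda>x. \<Sum>i. (1/5)^i * cos (100^i * x * pi) :: real) sequentially"
    by (rule Weierstrass_m_test[OF norm_weierstrass_term_le]) (simp add: summable_geometric)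
  then have "continuous_on S (\<lambda>x. \<Sum>i. (1/5)^i * cos (100^i * x * pi) :: real)"
    by (rule uniform_limit_theorem[rotated]) (auto intro!: always_eventually continuous_intros)
  then show ?thesis
    by (simp add: weierstrass_def[abs_def])
qed

lemma abs_cos_diff_le: "\<bar>cos x - cos y\<bar> \<le> \<bar>x - y :: real\<bar>"
proof -
  have "\<bar>cos x - cos y\<bar> = 2 * (\<bar>sin ((x + y) / 2)\<bar> * \<bar>sin ((y - x) / 2)\<bar>)"
    by (simp add: cos_diff_cos abs_mult)
  also have "\<dots> \<le> 2 * (1 * \<bar>(y - x) / 2\<bar>)"
    by (intro mult_left_mono mult_mono abs_sin_x_le_abs_x) auto
  finally show ?thesis by simp
qed

text \<open>
  At the scale \<open>100 ^ -N\<close> the term of index \<open>N\<close> dominates. Between two neighbouring multiples of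
  \<open>100 ^ -N\<close> it runs from \<open>-(1/5)^N\<close> to \<open>(1/5)^N\<close>, so one of the two is a point \<open>y\<close> at which it
  differs by at least \<open>(1/5)^N\<close> from its value at \<open>x\<close>. The earlier terms have slopes at most
  \<open>pi * 20^n\<close> and change by at most \<open>(pi/19) * (1/5)^N\<close> altogether, and the later terms by at most
  \<open>(1/2) * (1/5)^N\<close>. As \<open>pi/19 < 1/4\<close>, at least \<open>(1/4) * (1/5)^N\<close> remains.
\<close>

lemma weierstrass_oscillates:
  assumes x: "x \<in> {0..1}"
  shows "\<exists>y\<in>{0..1}. \<bar>y - x\<bar> \<le> (1/100)^N \<and> \<bar>weierstrass y - weierstrass x\<bar> \<ge> (1/5)^N / 4"
proof -
  define b :: real where "b = 100^N"
  have b: "b > 0" "b \<ge> 1" by (auto simp: b_def)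
  \<comment> \<open>A cell \<open>[k/b, (k+1)/b]\<close> around \<open>x\<close> inside \<open>{0..1}\<close>: for \<open>x = 1\<close> it has to lie to the left of \<open>x\<close>,
      so that \<open>k\<close> is not simply the integer part.\<close>
  obtain k :: nat where k: "real k \<le> b * x" "b * x \<le> real k + 1" "real k + 1 \<le> b"
  proof (cases "x = 1")
    case True
    show ?thesis
      by (rule that[of "100^N - 1"]) (use True in \<open>auto simp: b_def of_nat_diff\<close>)
  next
    case False
    define m where "m = nat \<lfloor>b * x\<rfloor>"
    have "b * x \<ge> 0" "b * x < b" using b x False by auto
    then have m: "real m \<le> b * x" "b * x < real m + 1"
      by (auto simp: m_def)
    then have "real m < b" using \<open>b * x < b\<close> by linarith
    then have "Suc m \<le> 100^N" by (simp add: b_def Suc_le_eq)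
    from of_nat_mono[OF this, where ?'a = real] have "real m + 1 \<le> b"
      unfolding b_def of_nat_Suc of_nat_power of_nat_numeral by linarith
    then show ?thesis using m by (intro that[of m]) linarith+
  qed
  \<comment> \<open>The cosine is \<open>1\<close> and \<open>-1\<close> at the two ends, and no number is closer than \<open>1\<close> to both.\<close>
  obtain j :: nat where j: "j = k \<or> j = Suc k"
    and jcos: "\<bar>cos (real j * pi) - cos (b * x * pi)\<bar> \<ge> 1"
  proof -
    have "\<bar>cos (real k * pi) - cos (b * x * pi)\<bar> \<ge> 1
        \<or> \<bar>cos (real (Suc k) * pi) - cos (b * x * pi)\<bar> \<ge> 1"
      unfolding cos_npi by (cases "even k") auto
    then show ?thesis using that by blast
  qed
  define y where "y = real j / b"
  have jx: "\<bar>real j - b * x\<bar> \<le> 1" and jb: "real j \<le> b" using j k by auto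
  have y01: "y \<in> {0..1}" using jb b by (auto simp: y_def field_simps)
  have "\<bar>y - x\<bar> = \<bar>real j - b * x\<bar> / b"
    using b by (simp add: y_def field_simps abs_if)
  also have "\<dots> \<le> 1 / b" using jx b by (simp add: divide_right_mono)
  finally have yx: "\<bar>y - x\<bar> \<le> 1 / b" .
  define d where "d n = (1/5)^n * cos (100^n * y * pi) - (1/5)^n * cos (100^n * x * pi)" for n
  have sd: "summable d" unfolding d_def by (intro summable_diff summable_weierstrass)
  have W: "weierstrass y - weierstrass x = suminf d"
    unfolding weierstrass_def d_def by (intro suminf_diff summable_weierstrass)
  have split: "suminf d = (\<Sum>n. d (n + Suc N)) + d N + (\<Sum>n<N. d n)"
    using suminf_split_initial_segment[OF sd, of "Suc N"] by simp
  have "\<bar>d n\<bar> \<le> 20^n * (pi / b)" for n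
  proof -
    have "\<bar>d n\<bar> = (1/5)^n * \<bar>cos (100^n * y * pi) - cos (100^n * x * pi)\<bar>"
      unfolding d_def by (simp flip: right_diff_distrib add: abs_mult)
    also have "\<dots> \<le> (1/5)^n * \<bar>100^n * y * pi - 100^n * x * pi\<bar>"
      by (intro mult_left_mono abs_cos_diff_le) auto
    also have "\<dots> = (1/5)^n * 100^n * (pi * \<bar>y - x\<bar>)"
      by (simp flip: right_diff_distrib left_diff_distrib add: abs_mult)
    also have "\<dots> \<le> (1/5)^n * 100^n * (pi * (1 / b))"
      by (intro mult_left_mono yx) auto
    also have "\<dots> = 20^n * (pi / b)" by (simp flip: power_mult_distrib)
    finally show ?thesis .
  qed
  then have "\<bar>\<Sum>n<N. d n\<bar> \<le> (\<Sum>n<N. 20^n * (pi / b))"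
    by (intro order.trans[OF sum_abs] sum_mono)
  also have "\<dots> = (20^N - 1) / 19 * (pi / b)"
    unfolding sum_distrib_right[symmetric] by (subst geometric_sum) auto
  also have "\<dots> \<le> 20^N / 19 * (pi / b)"
    using b by (intro mult_right_mono) auto
  also have "\<dots> = (20^N / b) * (pi / 19)" by simp
  also have "20^N / b = (1/5)^N" by (simp add: b_def flip: power_divide)
  also have "(1/5)^N * (pi / 19) \<le> (1/5)^N * (1/4)"
    using pi_less_4 by (intro mult_left_mono) auto
  finally have early: "\<bar>\<Sum>n<N. d n\<bar> \<le> (1/5)^N / 4" by simp
  have tail_term: "norm (d (n + Suc N)) \<le> 2 * (1/5)^Suc N * (1/5)^n" for n
  proof -
    have "norm (d (n + Suc N)) \<le> 2 * (1/5)^(n + Suc N)"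
      unfolding d_def mult_2
      by (rule order.trans[OF norm_triangle_ineq4 add_mono])
         (rule norm_weierstrass_term_le)+
    then show ?thesis by (simp add: power_add ac_simps)
  qed
  have "norm (\<Sum>n. d (n + Suc N)) \<le> (\<Sum>n. 2 * (1/5)^Suc N * (1/5)^n)"
    by (rule norm_suminf_le[OF tail_term]) (intro summable_mult summable_geometric, simp)
  also have "\<dots> = 2 * (1/5)^Suc N * (5/4)"
    by (subst suminf_mult) (auto simp: suminf_geometric summable_geometric)
  finally have late: "\<bar>\<Sum>n. d (n + Suc N)\<bar> \<le> (1/5)^N / 2" by simp
  have "100^N * y = real j" using b by (simp add: y_def b_def)
  then have "\<bar>d N\<bar> = (1/5)^N * \<bar>cos (real j * pi) - cos (b * x * pi)\<bar>"
    unfolding d_def b_def by (simp flip: right_diff_distrib add: abs_mult)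
  also have "\<dots> \<ge> (1/5)^N" using jcos by simp
  finally have main: "\<bar>d N\<bar> \<ge> (1/5)^N" .
  have "\<bar>weierstrass y - weierstrass x\<bar> \<ge> (1/5)^N / 4"
    unfolding W split using early late main by linarith
  then show ?thesis using y01 yx by (intro bexI[of _ y]) (auto simp: b_def power_divide)
qed

lemma weierstrass_steep:
  assumes x: "x \<in> {0..1}"
  shows "\<exists>y\<in>{0..1}. \<bar>weierstrass y - weierstrass x\<bar> > K * \<bar>y - x\<bar>"
proof -
  obtain N where N: "4 * \<bar>K\<bar> < 20^N"
    using real_arch_pow[of 20 "4 * \<bar>K\<bar>"] by auto
  obtain y where y: "y \<in> {0..1}" "\<bar>y - x\<bar> \<le> (1/100)^N"
      "\<bar>weierstrass y - weierstrass x\<bar> \<ge> (1/5)^N / 4"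
    using weierstrass_oscillates[OF x] by blast
  have "K * \<bar>y - x\<bar> \<le> \<bar>K\<bar> * (1/100)^N"
    using y(2) by (intro mult_mono) auto
  also have "\<dots> < (20^N / 4) * (1/100)^N"
    using N by (intro mult_strict_right_mono) auto
  also have "\<dots> = (1/5)^N / 4" by (simp flip: power_mult_distrib)
  also have "\<dots> \<le> \<bar>weierstrass y - weierstrass x\<bar>" by (rule y(3))
  finally show ?thesis using y(1) by blast
qed


section \<open>Points with bounded difference quotients\<close>

definition lipschitz_points :: "real \<Rightarrow> (real \<Rightarrow> real) \<Rightarrow> real set" where
  "lipschitz_points K g = {x\<in>{0..1}. \<forall>y\<in>{0..1}. \<bar>g y - g x\<bar> \<le> K * \<bar>y - x\<bar>}"

lemma closed_lipschitz_points:
  assumes "continuous_on {0..1} g"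
  shows "closed (lipschitz_points K g)"
proof -
  have "lipschitz_points K g
      = {0..1} \<inter> (\<Inter>y\<in>{0..1}. {x\<in>{0..1}. \<bar>g y - g x\<bar> \<le> K * \<bar>y - x\<bar>})"
    by (auto simp: lipschitz_points_def)
  moreover have "closed {x\<in>{0..1}. \<bar>g y - g x\<bar> \<le> K * \<bar>y - x\<bar>}" for y
    by (intro continuous_on_closed_Collect_le continuous_intros assms closed_atLeastAtMost)
  ultimately show ?thesis
    by (metis (no_types, lifting) closed_INT closed_Int closed_atLeastAtMost)
qed

lemma lipschitz_points_diff:
  assumes "x \<in> lipschitz_points K g" "x \<in> lipschitz_points L h"
  shows "x \<in> lipschitz_points (K + L) (\<lambda>s. g s - h s)"
proof -
  have "\<bar>(g y - h y) - (g x - h x)\<bar> \<le> (K + L) * \<bar>y - x\<bar>" if "y \<in> {0..1}" for y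
  proof -
    have "\<bar>g y - g x\<bar> \<le> K * \<bar>y - x\<bar>" "\<bar>h y - h x\<bar> \<le> L * \<bar>y - x\<bar>"
      using assms that by (auto simp: lipschitz_points_def)
    then show ?thesis unfolding distrib_right by linarith
  qed
  then show ?thesis using assms by (simp add: lipschitz_points_def)
qed

lemma lipschitz_points_weierstrass: "lipschitz_points K weierstrass = {}"
  unfolding lipschitz_points_def using weierstrass_steep[of _ K] linorder_not_less by blast

lemma lipschitz_points_scaled_weierstrass:
  assumes "c \<noteq> 0"
  shows "lipschitz_points K (\<lambda>s. c * weierstrass s) = {}"
proof -
  have "\<bar>c * weierstrass y - c * weierstrass x\<bar> \<le> K * \<bar>y - x\<bar>
      \<longleftrightarrow> \<bar>weierstrass y - weierstrass x\<bar> \<le> K / \<bar>c\<bar> * \<bar>y - x\<bar>" for x y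
    unfolding right_diff_distrib[symmetric] abs_mult using assms by (simp add: field_simps)
  then have "lipschitz_points K (\<lambda>s. c * weierstrass s) = lipschitz_points (K / \<bar>c\<bar>) weierstrass"
    by (simp add: lipschitz_points_def)
  then show ?thesis by (simp add: lipschitz_points_weierstrass)
qed

text \<open>
  Differentiability bounds the quotients near \<open>x\<close>. Away from \<open>x\<close> they are bounded because \<open>g\<close>
  is bounded and the denominators are bounded away from \<open>0\<close>.
\<close>

lemma differentiable_imp_lipschitz_point:
  assumes g: "g differentiable (at x within {0..1})" and x: "x \<in> {0..1}"
    and bounded: "\<And>y. y \<in> {0..1} \<Longrightarrow> \<bar>g y\<bar> \<le> M"
  shows "\<exists>n. x \<in> lipschitz_points (real n) g"
proof -
  obtain D where "(g has_real_derivative D) (at x within {0..1})"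
    using g by (auto simp: real_differentiable_def)
  then have "((\<lambda>y. (g y - g x) / (y - x)) \<longlongrightarrow> D) (at x within {0..1})"
    by (simp add: has_field_derivative_iff)
  then have "\<forall>\<^sub>F y in at x within {0..1}. dist ((g y - g x) / (y - x)) D < 1"
    by (rule tendstoD) simp
  then obtain \<delta> where \<delta>: "\<delta> > 0"
    "\<And>y. y \<in> {0..1} \<Longrightarrow> y \<noteq> x \<Longrightarrow> dist y x < \<delta> \<Longrightarrow> dist ((g y - g x) / (y - x)) D < 1"
    by (auto simp: eventually_at)
  have M: "M \<ge> 0" using bounded[OF x] by linarith
  obtain n where n: "real n \<ge> max (\<bar>D\<bar> + 1) (2 * M / \<delta>)" using real_arch_simple by blast
  have "\<bar>g y - g x\<bar> \<le> real n * \<bar>y - x\<bar>" if y: "y \<in> {0..1}" for y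
  proof (cases "y = x")
    case False
    show ?thesis
    proof (cases "dist y x < \<delta>")
      case True
      then have "\<bar>(g y - g x) / (y - x) - D\<bar> < 1"
        using \<delta>(2)[OF y False] by (simp add: dist_real_def)
      then have "\<bar>(g y - g x) / (y - x)\<bar> \<le> real n" using n by linarith
      then show ?thesis using False by (simp add: abs_divide field_simps)
    next
      case far: False
      have "\<bar>g y - g x\<bar> \<le> 2 * M" using bounded[OF y] bounded[OF x] by linarith
      also have "\<dots> = 2 * M / \<delta> * \<delta>" using \<delta> by simp
      also have "\<dots> \<le> real n * \<bar>y - x\<bar>"
        using n far \<delta>(1) M by (intro mult_mono) (auto simp: dist_real_def)
      finally show ?thesis .
    qed
  qed simp
  then have "x \<in> lipschitz_points (real n) g" using x by (simp add: lipschitz_points_def)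
  then show ?thesis by blast
qed


section \<open>Two facts on finite measures\<close>

text \<open>A sum of nonnegative terms whose finite partial sums are bounded has countable support.\<close>

lemma (in finite_measure) countable_positive_measure_disjoint_family:
  assumes disj: "disjoint_family_on A I" and sets: "\<And>i. i \<in> I \<Longrightarrow> A i \<in> sets M"
  shows "countable {i\<in>I. measure M (A i) \<noteq> 0}"
proof (rule summable_countable_real, rule nonneg_bdd_above_summable_on)
  have "sum (\<lambda>i. measure M (A i)) F \<le> measure M (space M)" if "F \<subseteq> I" "finite F" for F
  proof -
    have "sum (\<lambda>i. measure M (A i)) F = measure M (\<Union>i\<in>F. A i)"
      using that sets disjoint_family_on_mono[OF that(1) disj]
      by (intro finite_measure_finite_Union[symmetric]) auto
    also have "\<dots> \<le> measure M (space M)" by (rule bounded_measure)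
    finally show ?thesis .
  qed
  then show "bdd_above (sum (\<lambda>i. measure M (A i)) ` {F. F \<subseteq> I \<and> finite F})"
    by (auto intro!: bdd_aboveI)
qed simp

lemma (in finite_measure) measure_limsup_ge:
  fixes A :: "nat \<Rightarrow> 'a set"
  assumes sets: "\<And>j. A j \<in> sets M" and c: "\<And>j. c \<le> measure M (A j)"
  shows "c \<le> measure M (\<Inter>m. \<Union>j\<in>{m..}. A j)"
proof (rule LIMSEQ_le_const)
  show "(\<lambda>m. measure M (\<Union>j\<in>{m..}. A j)) \<longlonglongrightarrow> measure M (\<Inter>m. \<Union>j\<in>{m..}. A j)"
    using sets by (intro finite_Lim_measure_decseq) (auto simp: decseq_def, force)
  have "c \<le> measure M (\<Union>j\<in>{m..}. A j)" for m
    using sets by (intro order.trans[OF c[of m]] finite_measure_mono) auto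
  then show "\<exists>N. \<forall>m\<ge>N. c \<le> measure M (\<Union>j\<in>{m..}. A j)" by blast
qed


section \<open>A Borel hull in the space of continuous functions\<close>

text \<open>Only the values on \<open>{0..1}\<close> matter, since \<open>ui_of_real\<close> is unspecified elsewhere.\<close>

definition on_reals :: "C01 \<Rightarrow> real \<Rightarrow> real" where
  "on_reals f s = apply_bcontfun f (ui_of_real s)"

lemma on_reals_add: "on_reals (f + g) s = on_reals f s + on_reals g s"
  and on_reals_scaleR: "on_reals (c *\<^sub>R f) s = c * on_reals f s"
  by (simp_all add: on_reals_def)

lemma continuous_on_on_reals: "continuous_on {0..1} (on_reals f)"
  unfolding on_reals_def
  by (rule continuous_on_compose2[OF continuous_on_apply_bcontfun[of UNIV] continuous_on_ui_of_real])
     auto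

lemma tendsto_on_reals:
  assumes "(f \<longlongrightarrow> l) F"
  shows "((\<lambda>j. on_reals (f j) s) \<longlongrightarrow> on_reals l s) F"
  unfolding on_reals_def
  by (rule tendsto_uniform_limitI[OF tendsto_bcontfun_uniform_limit[OF assms]]) simp

abbreviation unit_measure :: "real measure" where
  "unit_measure \<equiv> lebesgue_on {0..1}"

lemma finite_unit_measure: "finite_measure unit_measure"
  by (rule finite_measure_lebesgue_on) simp

lemma sets_lipschitz_points: "lipschitz_points K (on_reals f) \<in> sets unit_measure"
proof -
  have "lipschitz_points K (on_reals f) \<in> sets lebesgue"
    using closed_lipschitz_points[OF continuous_on_on_reals] by (simp add: borel_closed)
  then show ?thesis
    by (auto simp: sets_restrict_space_iff lipschitz_points_def)
qed

definition positive_lipschitz :: "C01 set" where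
  "positive_lipschitz = {f. \<exists>n::nat. measure unit_measure (lipschitz_points n (on_reals f)) \<noteq> 0}"

text \<open>
  If \<open>f j \<longlonglongrightarrow> f\<close>, then a point that lies in the Lipschitz sets of infinitely many \<open>f j\<close> also lies
  in that of \<open>f\<close>, because the defining inequalities pass to the limit.
\<close>

lemma closed_lipschitz_measure_ge:
  "closed {f. c \<le> measure unit_measure (lipschitz_points K (on_reals f))}"
  unfolding closed_sequential_limits
proof (intro allI impI, elim conjE)
  interpret finite_measure unit_measure by (rule finite_unit_measure)
  fix f l
  assume f: "\<forall>j. f j \<in> {f. c \<le> measure unit_measure (lipschitz_points K (on_reals f))}"
    and lim: "f \<longlonglongrightarrow> l"
  define A where "A j = lipschitz_points K (on_reals (f j))" for j
  have "c \<le> measure unit_measure (\<Inter>m. \<Union>j\<in>{m..}. A j)"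
    using f by (intro measure_limsup_ge) (auto simp: A_def sets_lipschitz_points)
  also have "\<dots> \<le> measure unit_measure (lipschitz_points K (on_reals l))"
  proof (rule finite_measure_mono[OF _ sets_lipschitz_points], rule subsetI)
    fix x assume "x \<in> (\<Inter>m. \<Union>j\<in>{m..}. A j)"
    then have often: "\<And>m. \<exists>j\<ge>m. x \<in> A j" by auto
    then have x: "x \<in> {0..1}" by (auto simp: A_def lipschitz_points_def)
    have "\<bar>on_reals l y - on_reals l x\<bar> \<le> K * \<bar>y - x\<bar>" if y: "y \<in> {0..1}" for y
    proof (rule ccontr)
      assume "\<not> ?thesis"
      then have "K * \<bar>y - x\<bar> < \<bar>on_reals l y - on_reals l x\<bar>" by simp
      moreover have "(\<lambda>j. \<bar>on_reals (f j) y - on_reals (f j) x\<bar>)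
          \<longlonglongrightarrow> \<bar>on_reals l y - on_reals l x\<bar>"
        by (intro tendsto_intros tendsto_on_reals lim)
      ultimately have "\<forall>\<^sub>F j in sequentially.
          K * \<bar>y - x\<bar> < \<bar>on_reals (f j) y - on_reals (f j) x\<bar>"
        by (rule order_tendstoD(1)[rotated])
      then obtain m where "\<And>j. j \<ge> m \<Longrightarrow> K * \<bar>y - x\<bar> < \<bar>on_reals (f j) y - on_reals (f j) x\<bar>"
        by (auto simp: eventually_sequentially)
      then show False
        using often[of m] y by (force simp: A_def lipschitz_points_def)
    qed
    then show "x \<in> lipschitz_points K (on_reals l)"
      using x by (auto simp: lipschitz_points_def)
  qed
  finally show "l \<in> {f. c \<le> measure unit_measure (lipschitz_points K (on_reals f))}" by simp
qed

lemma borel_positive_lipschitz: "positive_lipschitz \<in> sets borel"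
proof -
  have "positive_lipschitz = (\<Union>n::nat. \<Union>k::nat.
      {f. inverse (real (Suc k)) \<le> measure unit_measure (lipschitz_points n (on_reals f))})"
  proof -
    have "r \<noteq> 0 \<longleftrightarrow> (\<exists>k::nat. inverse (real (Suc k)) \<le> r)" if "r \<ge> 0" for r :: real
      using that reals_Archimedean[of r]
      by (metis inverse_positive_iff_positive less_eq_real_def not_le of_nat_0_less_iff zero_less_Suc)
    then show ?thesis by (auto simp: positive_lipschitz_def)
  qed
  then show ?thesis
    by (elim ssubst)
       (intro sets.countable_UN image_subsetI borel_closed closed_lipschitz_measure_ge)
qed

lemma positive_diff_points_subset:
  "{f. emeasure lebesgue (diff_points f) > 0} \<subseteq> positive_lipschitz"
proof (rule subsetI, rule ccontr)
  fix f assume pos: "f \<in> {f. emeasure lebesgue (diff_points f) > 0}"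
    and notin: "f \<notin> positive_lipschitz"
  interpret finite_measure unit_measure by (rule finite_unit_measure)
  let ?L = "\<lambda>n::nat. lipschitz_points n (on_reals f)"
  have L: "?L n \<in> null_sets lebesgue" for n
  proof -
    have "emeasure unit_measure (?L n) = 0"
      using notin by (simp add: positive_lipschitz_def emeasure_eq_measure)
    then have "?L n \<in> null_sets unit_measure"
      by (intro null_setsI sets_lipschitz_points)
    then show ?thesis by (simp add: null_sets_restrict_space)
  qed
  obtain M where "\<And>u. \<bar>apply_bcontfun f u\<bar> \<le> M"
    using bounded_apply_bcontfun[of f] unfolding bounded_iff by auto
  then have "diff_points f \<subseteq> (\<Union>n. ?L n)"
    using differentiable_imp_lipschitz_point[of "on_reals f" _ M]
    unfolding diff_points_def on_reals_def by blast
  then have "emeasure lebesgue (diff_points f) \<le> emeasure lebesgue (\<Union>n. ?L n)"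
    using L by (intro emeasure_mono) auto
  also have "\<dots> = 0" using L by (intro null_setsD1 null_sets_UN)
  finally show False using pos by simp
qed


section \<open>Translates along a line\<close>

definition weierstrass_C01 :: C01 where
  "weierstrass_C01 = Bcontfun (\<lambda>u. weierstrass (real_of_ui u))"

lemma on_reals_weierstrass_C01:
  assumes "s \<in> {0..1}"
  shows "on_reals weierstrass_C01 s = weierstrass s"
proof -
  have cont: "continuous_on UNIV (\<lambda>u. weierstrass (real_of_ui u))"
    by (rule continuous_on_compose2[OF continuous_on_weierstrass[of UNIV]])
       (auto simp: continuous_on_iff dist_unit_interval_def)
  moreover have "bounded (range (\<lambda>u. weierstrass (real_of_ui u)))"
    by (intro compact_imp_bounded compact_continuous_image cont compact_UNIV_class)
  ultimately have "(\<lambda>u. weierstrass (real_of_ui u)) \<in> bcontfun" by (simp add: bcontfun_def)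
  then show ?thesis
    using assms
    by (simp add: on_reals_def weierstrass_C01_def Bcontfun_inverse ui_of_real_inverse)
qed

text \<open>
  Subtracting two translates cancels the unknown \<open>f\<close> and leaves a nonzero multiple of
  Weierstrass's function.
\<close>

lemma disjoint_lipschitz_translates:
  "disjoint_family (\<lambda>t. lipschitz_points K (on_reals (t *\<^sub>R weierstrass_C01 + f)))"
  unfolding disjoint_family_on_def
proof (intro ballI impI)
  fix s t :: real assume "s \<noteq> t"
  let ?g = "\<lambda>t. on_reals (t *\<^sub>R weierstrass_C01 + f)"
  have "x \<in> lipschitz_points (K + K) (\<lambda>y. (s - t) * weierstrass y)"
    if "x \<in> lipschitz_points K (?g s)" "x \<in> lipschitz_points K (?g t)" for x
    using lipschitz_points_diff[OF that]
    by (auto simp: lipschitz_points_def on_reals_add on_reals_scaleR on_reals_weierstrass_C01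
        left_diff_distrib)
  then show "lipschitz_points K (?g s) \<inter> lipschitz_points K (?g t) = {}"
    using lipschitz_points_scaled_weierstrass[of "s - t"] \<open>s \<noteq> t\<close> by auto
qed

lemma countable_positive_translates:
  "countable {t. t *\<^sub>R weierstrass_C01 + f \<in> positive_lipschitz}"
proof -
  interpret finite_measure unit_measure by (rule finite_unit_measure)
  let ?m = "\<lambda>n t. measure unit_measure (lipschitz_points n (on_reals (t *\<^sub>R weierstrass_C01 + f)))"
  have "countable {t\<in>UNIV. ?m n t \<noteq> 0}" for n
    by (intro countable_positive_measure_disjoint_family disjoint_lipschitz_translates
        sets_lipschitz_points)
  then have "countable (\<Union>n::nat. {t. ?m n t \<noteq> 0})" by simp
  then show ?thesis by (rule countable_subset[rotated]) (auto simp: positive_lipschitz_def)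
qed


section \<open>A Cantor set of reals\<close>

text \<open>
  The digits are \<open>0\<close> and \<open>1\<close> in base \<open>3\<close>, so that a change of the first digit outweighs all
  changes of later digits.
\<close>

definition cantor_real :: "(nat \<Rightarrow> bool) \<Rightarrow> real" where
  "cantor_real s = (\<Sum>n. of_bool (s n) * (1/3)^n)"

lemma norm_cantor_term_le: "norm (of_bool b * (1/3)^n :: real) \<le> (1/3)^n"
  by (cases b) auto

lemma summable_cantor: "summable (\<lambda>n. of_bool (s n) * (1/3)^n :: real)"
  by (rule summable_comparison_test'[where g = "\<lambda>n. (1/3)^n" and N = 0])
     (use norm_cantor_term_le in \<open>auto intro: summable_geometric\<close>)

lemma cantor_real_bounds: "0 \<le> cantor_real s" "cantor_real s \<le> 3/2"
proof -
  show "0 \<le> cantor_real s" unfolding cantor_real_def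
    by (intro suminf_nonneg summable_cantor) auto
  have "cantor_real s \<le> (\<Sum>n. (1/3)^n)" unfolding cantor_real_def
    by (intro suminf_le summable_cantor summable_geometric) auto
  then show "cantor_real s \<le> 3/2" by (simp add: suminf_geometric)
qed

lemma cantor_real_unfold: "cantor_real s = of_bool (s 0) + cantor_real (\<lambda>n. s (Suc n)) / 3"
proof -
  have "cantor_real s = of_bool (s 0) + (\<Sum>n. of_bool (s (Suc n)) * (1/3)^Suc n)"
    unfolding cantor_real_def using suminf_split_head[OF summable_cantor[of s]] by simp
  also have "(\<Sum>n. of_bool (s (Suc n)) * (1/3)^Suc n) = (\<Sum>n. of_bool (s (Suc n)) * (1/3)^n / 3 :: real)"
    by simp
  also have "\<dots> = cantor_real (\<lambda>n. s (Suc n)) / 3"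
    unfolding cantor_real_def by (rule suminf_divide[OF summable_cantor])
  finally show ?thesis .
qed

lemma inj_cantor_real: "inj cantor_real"
proof (rule injI, rule ext)
  fix s t :: "nat \<Rightarrow> bool" and n
  assume "cantor_real s = cantor_real t"
  then show "s n = t n"
  proof (induction n arbitrary: s t)
    case 0
    then show ?case
      using cantor_real_unfold[of s] cantor_real_unfold[of t]
        cantor_real_bounds[of "\<lambda>n. s (Suc n)"] cantor_real_bounds[of "\<lambda>n. t (Suc n)"]
      by (cases "s 0"; cases "t 0") auto
  next
    case (Suc n)
    have "cantor_real (\<lambda>n. s (Suc n)) = cantor_real (\<lambda>n. t (Suc n))"
      using Suc.prems cantor_real_unfold[of s] cantor_real_unfold[of t]
        cantor_real_bounds[of "\<lambda>n. s (Suc n)"] cantor_real_bounds[of "\<lambda>n. t (Suc n)"]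
      by (cases "s 0"; cases "t 0") auto
    from Suc.IH[OF this] show ?case .
  qed
qed

lemma continuous_on_cantor_real: "continuous_on UNIV cantor_real"
proof -
  have "continuous_on UNIV (\<lambda>s :: nat \<Rightarrow> bool. of_bool (s i) :: real)" for i
    by (rule continuous_on_compose2[OF _ continuous_on_product_coordinates, of UNIV])
       (auto simp: continuous_on_open_vimage intro: open_discrete)
  then have partial: "continuous_on UNIV (\<lambda>s :: nat \<Rightarrow> bool. \<Sum>i<n. of_bool (s i) * (1/3)^i :: real)"
    for n
    by (intro continuous_on_sum continuous_on_mult continuous_on_const)
  have "uniform_limit UNIV (\<lambda>n s. \<Sum>i<n. of_bool (s i) * (1/3)^i)
          (\<lambda>s. \<Sum>i. of_bool (s i) * (1/3)^i :: real) sequentially"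
    by (rule Weierstrass_m_test[OF norm_cantor_term_le]) (simp add: summable_geometric)
  then have "continuous_on UNIV (\<lambda>s. \<Sum>i. of_bool (s i) * (1/3)^i :: real)"
    by (rule uniform_limit_theorem[OF always_eventually, rotated]) (intro allI partial trivial_limit_sequentially)+
  then show ?thesis
    by (simp add: cantor_real_def[abs_def])
qed

lemma compact_cantor_space: "compact (UNIV :: (nat \<Rightarrow> bool) set)"
proof -
  have "compact_space (product_topology (\<lambda>_::nat. euclidean :: bool topology) UNIV)"
    unfolding compact_space_product_topology by (simp add: compact_space_def finite_imp_compact)
  then show ?thesis
    by (simp add: euclidean_product_topology compact_space_def)
qed

lemma homeomorphic_cantor_line:
  fixes w :: "'a::real_normed_vector"
  assumes "w \<noteq> 0"
  shows "range (\<lambda>s. cantor_real s *\<^sub>R w) homeomorphic (UNIV :: (nat \<Rightarrow> bool) set)"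
proof -
  have "inj (\<lambda>s. cantor_real s *\<^sub>R w)"
    using assms by (auto intro!: injI dest: injD[OF inj_cantor_real])
  then have "(UNIV :: (nat \<Rightarrow> bool) set) homeomorphic range (\<lambda>s. cantor_real s *\<^sub>R w)"
    by (intro homeomorphic_compact[where f = "\<lambda>s. cantor_real s *\<^sub>R w"] compact_cantor_space)
       (auto intro!: continuous_intros continuous_on_cantor_real)
  then show ?thesis by (rule homeomorphic_sym[THEN iffD1])
qed


section \<open>Haar-countability\<close>

theorem proposition3p8:
  shows "haar_countable {f :: C01. emeasure lebesgue (diff_points f) > 0}"
  unfolding haar_countable_def
proof (intro exI conjI allI)
  let ?C = "range (\<lambda>s. cantor_real s *\<^sub>R weierstrass_C01)"
  show "positive_lipschitz \<in> sets borel" by (rule borel_positive_lipschitz)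
  show "{f. emeasure lebesgue (diff_points f) > 0} \<subseteq> positive_lipschitz"
    by (rule positive_diff_points_subset)
  have "weierstrass_C01 \<noteq> 0"
  proof
    assume "weierstrass_C01 = 0"
    then have "weierstrass s = 0" if "s \<in> {0..1}" for s
      using on_reals_weierstrass_C01[OF that] by (simp add: on_reals_def)
    then show False using weierstrass_steep[of 0 0] by auto
  qed
  then show "?C homeomorphic (UNIV :: (nat \<Rightarrow> bool) set)" by (rule homeomorphic_cantor_line)
  fix f :: C01
  have "countable ((\<lambda>t. t *\<^sub>R weierstrass_C01 + f) `
      {t. t *\<^sub>R weierstrass_C01 + f \<in> positive_lipschitz})"
    by (intro countable_image countable_positive_translates)
  then show "countable ((\<lambda>c. c + f) ` ?C \<inter> positive_lipschitz)"
    by (rule countable_subset[rotated]) auto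
qed

end
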